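(* Let $T=L_{124}\oplus L_{125}\oplus L_{126}\oplus L_{127}\oplus L_{128}\oplus L_{134}\oplus L_{145}\oplus L_{156}\oplus L_{167}\oplus L_{178}$, a basic cluster-tilting object of $\underline{\mathrm{CM}}(B_{3,9})$, and let $\mathbf{g}\in\mathbb{Z}^{10}$ be the vector with coordinates $-1$ at $L_{134},L_{125},L_{126}$, coordinates $1$ at $L_{156},L_{167},L_{128}$, and coordinates $0$ at $L_{145},L_{178},L_{124},L_{127}$. Then $\mathfrak{e}(t\mathbf{g})>0$ for every positive integer $t$.
   Context: $Q_C$ is the quiver with vertex set $\mathbb{Z}_n$ and arrows $x_i:i-1\to i$, $y_i:i\to i-1$; $B_{k,n}$ is the quotient of the complete path algebra $\widehat{\mathbb{C}Q_C}$ by the relations $xy=yx$, $x^k=y^{n-k}$ (at every vertex, with appropriate subscripts), with center $Z=\mathbb{C}[[t]]$, $t=\sum x_iy_i$. $\mathrm{CM}(B_{k,n})$ is the Frobenius category of $B_{k,n}$-modules free of finite rank over $Z$; $\underline{\mathrm{CM}}(B_{k,n})$ is its stable category, a 2-Calabi–Yau triangulated category with suspension $\Sigma$. For a $k$-subset $I\subset[n]$, $L_I$ is the rank one module with $\mathbb{C}[[t]]$ at each vertex, $x_i$ acting by $1$ if $i\in I$ and by $t$ otherwise, $y_i$ acting by $t$ if $i\in I$ and by $1$ otherwise; $L_{abc}$ stands for $L_{\{a,b,c\}}$. For a basic cluster-tilting object $T=\bigoplus_iT_i$ of $\mathcal{C}=\underline{\mathrm{CM}}(B_{k,n})$ and an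 integer vector $\mathbf{g}$ indexed by the summands $T_i$, put $T^{\mathbf{g}_+}=\bigoplus_iT_i^{\max(g_i,0)}$, $T^{\mathbf{g}_-}=\bigoplus_iT_i^{\max(-g_i,0)}$. For $f\in\mathrm{Hom}_{\mathcal{C}}(T^{\mathbf{g}_-},T^{\mathbf{g}_+})$ let $T_f^\bullet$ be the two-term complex $T^{\mathbf{g}_-}\xrightarrow{f}T^{\mathbf{g}_+}$ in $K^b(\mathrm{add}\,T)$. Then $\mathfrak{e}(\mathbf{g})$ is the generic (equivalently minimal) value of $f\mapsto\dim\mathrm{Hom}_{K^b(\mathrm{add}\,T)}(T_f^\bullet,\Sigma T_f^\bullet)$ on $\mathrm{Hom}_{\mathcal{C}}(T^{\mathbf{g}_-},T^{\mathbf{g}_+})$. *)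

theory Defs
  imports
    "Jordan_Normal_Form.Matrix"
    "HOL-Computational_Algebra.Formal_Power_Series"
    "HOL-Library.Numeral_Type"
    "HOL-Library.Extended_Nat"
begin

text \<open>
  The vertex set \<open>\<int>\<^sub>n\<close> of the quiver is a numeral type \<open>'n\<close> with \<open>CARD('n) = n\<close>, so vertices are
  added modulo \<open>n\<close> (and \<open>n\<close> itself is the vertex \<open>0\<close>).  Over \<open>Z = \<complex>[[t]]\<close>, with \<open>t\<close> written
  \<^term>\<open>fps_X\<close>, the algebra \<open>B\<^bsub>k,n\<^esub>\<close> is generated by the vertex idempotents and the arrows, and
  \<open>t = \<Sum>x\<^sub>i y\<^sub>i\<close>.  A module that is free of finite rank over \<open>Z\<close> is therefore given, after a choice
  of bases, by a free module \<open>Z\<^bsup>rk i\<^esup>\<close> at each vertex \<open>i\<close> and by matrices over \<open>Z\<close> for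
  \<open>x\<^sub>i : i - 1 \<rightarrow> i\<close> and \<open>y\<^sub>i : i \<rightarrow> i - 1\<close>, acting on column vectors.
\<close>

record 'n qrep =
  rk :: "'n \<Rightarrow> nat"
  xm :: "'n \<Rightarrow> complex fps mat"
  ym :: "'n \<Rightarrow> complex fps mat"

primrec xpow :: "('n::{finite,comm_ring_1}) qrep \<Rightarrow> nat \<Rightarrow> 'n \<Rightarrow> complex fps mat" where
  "xpow M 0 v = 1\<^sub>m (rk M v)"
| "xpow M (Suc m) v = xm M (v + of_nat (Suc m)) * xpow M m v"

primrec ypow :: "('n::{finite,comm_ring_1}) qrep \<Rightarrow> nat \<Rightarrow> 'n \<Rightarrow> complex fps mat" where
  "ypow M 0 v = 1\<^sub>m (rk M v)"
| "ypow M (Suc m) v = ym M (v - of_nat m) * ypow M m v"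

text \<open>
  The second and third conditions contain both the relation \<open>xy = yx\<close> and the requirement that the
  central element \<open>t = \<Sum>x\<^sub>i y\<^sub>i\<close> acts as the scalar \<open>t\<close>.
\<close>

definition CM :: "nat \<Rightarrow> ('n::{finite,comm_ring_1}) qrep set" where
  "CM k = {M.
     (\<forall>i. xm M i \<in> carrier_mat (rk M i) (rk M (i - 1)) \<and>
          ym M i \<in> carrier_mat (rk M (i - 1)) (rk M i)) \<and>
     (\<forall>i. xm M i * ym M i = fps_X \<cdot>\<^sub>m 1\<^sub>m (rk M i)) \<and>
     (\<forall>i. ym M i * xm M i = fps_X \<cdot>\<^sub>m 1\<^sub>m (rk M (i - 1))) \<and>
     (\<forall>v. xpow M k v = ypow M (CARD('n) - k) v)}"

type_synonym 'n mor = "'n \<Rightarrow> complex fps mat"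

definition cm_hom :: "('n::{finite,comm_ring_1}) qrep \<Rightarrow> 'n qrep \<Rightarrow> 'n mor set" where
  "cm_hom M N = {f. (\<forall>i. f i \<in> carrier_mat (rk N i) (rk M i)) \<and>
                    (\<forall>i. f i * xm M i = xm N i * f (i - 1)) \<and>
                    (\<forall>i. f (i - 1) * ym M i = ym N i * f i)}"

definition mcomp :: "'n mor \<Rightarrow> 'n mor \<Rightarrow> 'n mor" where
  "mcomp g f = (\<lambda>i. g i * f i)"

definition madd :: "'n mor \<Rightarrow> 'n mor \<Rightarrow> 'n mor" where
  "madd f g = (\<lambda>i. f i + g i)"

definition mdiff :: "'n mor \<Rightarrow> 'n mor \<Rightarrow> 'n mor" where
  "mdiff f g = (\<lambda>i. f i - g i)"

definition zero_mor :: "'n qrep \<Rightarrow> 'n qrep \<Rightarrow> 'n mor" where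
  "zero_mor M N = (\<lambda>i. 0\<^sub>m (rk N i) (rk M i))"

definition cm_surj :: "'n qrep \<Rightarrow> 'n qrep \<Rightarrow> 'n mor \<Rightarrow> bool" where
  "cm_surj M N p \<longleftrightarrow>
     (\<forall>i. \<forall>w \<in> carrier_vec (rk N i). \<exists>v \<in> carrier_vec (rk M i). p i *\<^sub>v v = w)"

text \<open>
  The projective (equivalently injective) objects of the Frobenius category.  Its admissible
  epimorphisms are the surjections: the kernel of a surjection between modules in \<^const>\<open>CM\<close> is
  again free of finite rank over \<open>\<complex>[[t]]\<close>.
\<close>

definition cm_projective :: "nat \<Rightarrow> ('n::{finite,comm_ring_1}) qrep \<Rightarrow> bool" where
  "cm_projective k P \<longleftrightarrow> P \<in> CM k \<and>
     (\<forall>M \<in> CM k. \<forall>N \<in> CM k. \<forall>p \<in> cm_hom M N. \<forall>g \<in> cm_hom P N.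
        cm_surj M N p \<longrightarrow> (\<exists>h \<in> cm_hom P M. mcomp p h = g))"

text \<open>
  Morphisms of the stable category are represented by module homomorphisms; \<open>stable_eq\<close> is the
  equality of the morphisms they represent.
\<close>

definition stable_eq ::
  "nat \<Rightarrow> ('n::{finite,comm_ring_1}) qrep \<Rightarrow> 'n qrep \<Rightarrow> 'n mor \<Rightarrow> 'n mor \<Rightarrow> bool" where
  "stable_eq k M N f g \<longleftrightarrow>
     (\<exists>P. cm_projective k P \<and> (\<exists>u \<in> cm_hom M P. \<exists>v \<in> cm_hom P N. mdiff f g = mcomp v u))"

definition zero_rep :: "'n qrep" where
  "zero_rep = \<lparr>rk = (\<lambda>_. 0), xm = (\<lambda>_. 0\<^sub>m 0 0), ym = (\<lambda>_. 0\<^sub>m 0 0)\<rparr>"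

definition dsum :: "('n::{finite,comm_ring_1}) qrep \<Rightarrow> 'n qrep \<Rightarrow> 'n qrep" where
  "dsum M N = \<lparr>
     rk = (\<lambda>i. rk M i + rk N i),
     xm = (\<lambda>i. four_block_mat (xm M i) (0\<^sub>m (rk M i) (rk N (i - 1)))
                              (0\<^sub>m (rk N i) (rk M (i - 1))) (xm N i)),
     ym = (\<lambda>i. four_block_mat (ym M i) (0\<^sub>m (rk M (i - 1)) (rk N i))
                              (0\<^sub>m (rk N (i - 1)) (rk M i)) (ym N i))\<rparr>"

definition dsum_list :: "('n::{finite,comm_ring_1}) qrep list \<Rightarrow> 'n qrep" where
  "dsum_list Ms = foldr dsum Ms zero_rep"

definition L :: "('n::{finite,comm_ring_1}) set \<Rightarrow> 'n qrep" where
  "L I = \<lparr>rk = (\<lambda>_. 1),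
          xm = (\<lambda>i. mat 1 1 (\<lambda>_. if i \<in> I then 1 else fps_X)),
          ym = (\<lambda>i. mat 1 1 (\<lambda>_. if i \<in> I then fps_X else 1))\<rparr>"

text \<open>
  Complexes over the stable category, cohomologically graded.  For \<open>T\<close> in the stable category
  \<open>\<C>\<close>, \<open>K\<^sup>b(add T)\<close> is a full subcategory of the homotopy category of complexes over \<open>\<C>\<close>, so its
  morphism spaces are given by the chain maps and homotopies below.  All equations of morphisms
  are equations in \<open>\<C>\<close>.
\<close>

record 'n cpx =
  ob :: "int \<Rightarrow> 'n qrep"
  df :: "int \<Rightarrow> 'n mor"  \<comment> \<open>\<open>df C p\<close> goes from \<open>ob C p\<close> to \<open>ob C (p + 1)\<close>\<close>

definition shift :: "'n cpx \<Rightarrow> 'n cpx" where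
  "shift C = \<lparr>ob = (\<lambda>p. ob C (p + 1)), df = (\<lambda>p i. - df C (p + 1) i)\<rparr>"

definition two_term_ob :: "'n qrep \<Rightarrow> 'n qrep \<Rightarrow> int \<Rightarrow> 'n qrep" where
  "two_term_ob M N p = (if p = -1 then M else if p = 0 then N else zero_rep)"

definition two_term :: "'n qrep \<Rightarrow> 'n qrep \<Rightarrow> 'n mor \<Rightarrow> 'n cpx" where
  "two_term M N f = \<lparr>
     ob = two_term_ob M N,
     df = (\<lambda>p. if p = -1 then f
               else zero_mor (two_term_ob M N p) (two_term_ob M N (p + 1)))\<rparr>"

definition chain_maps ::
  "nat \<Rightarrow> ('n::{finite,comm_ring_1}) cpx \<Rightarrow> 'n cpx \<Rightarrow> (int \<Rightarrow> 'n mor) set" where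
  "chain_maps k C D = {h. \<forall>p. h p \<in> cm_hom (ob C p) (ob D p) \<and>
     stable_eq k (ob C p) (ob D (p + 1)) (mcomp (df D p) (h p)) (mcomp (h (p + 1)) (df C p))}"

definition homotopic :: "nat \<Rightarrow> ('n::{finite,comm_ring_1}) cpx \<Rightarrow> 'n cpx \<Rightarrow>
    (int \<Rightarrow> 'n mor) \<Rightarrow> (int \<Rightarrow> 'n mor) \<Rightarrow> bool" where
  "homotopic k C D h h' \<longleftrightarrow>
     (\<exists>s. (\<forall>p. s p \<in> cm_hom (ob C p) (ob D (p - 1))) \<and>
          (\<forall>p. stable_eq k (ob C p) (ob D p) (mdiff (h p) (h' p))
                 (madd (mcomp (df D (p - 1)) (s p)) (mcomp (s (p + 1)) (df C p)))))"

definition lin_comb :: "'n cpx \<Rightarrow> 'n cpx \<Rightarrow>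
    ((int \<Rightarrow> 'n mor) \<Rightarrow> complex) \<Rightarrow> (int \<Rightarrow> 'n mor) set \<Rightarrow> int \<Rightarrow> 'n mor" where
  "lin_comb C D c B = (\<lambda>p i. mat (rk (ob D p) i) (rk (ob C p) i)
     (\<lambda>rs. \<Sum>b\<in>B. fps_const (c b) * (b p i $$ rs)))"

text \<open>
  \<open>B\<close> represents a finite \<open>\<complex>\<close>-basis of the space of chain maps modulo homotopy.
\<close>

definition hom_basis ::
  "nat \<Rightarrow> ('n::{finite,comm_ring_1}) cpx \<Rightarrow> 'n cpx \<Rightarrow> (int \<Rightarrow> 'n mor) set \<Rightarrow> bool" where
  "hom_basis k C D B \<longleftrightarrow> finite B \<and> B \<subseteq> chain_maps k C D \<and>
     (\<forall>h \<in> chain_maps k C D. \<exists>!c. c \<in> B \<rightarrow>\<^sub>E UNIV \<and> homotopic k C D h (lin_comb C D c B))"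

text \<open>
  All bases have the same cardinality, so the infimum is the dimension; it is \<open>\<infinity>\<close> if there is no
  finite basis.
\<close>

definition hom_dim :: "nat \<Rightarrow> ('n::{finite,comm_ring_1}) cpx \<Rightarrow> 'n cpx \<Rightarrow> enat" where
  "hom_dim k C D = (INF B \<in> {B. hom_basis k C D B}. enat (card B))"

text \<open>
  Here \<open>T\<close> is a family of modules indexed by the entries of the list \<open>js\<close>, and \<open>nat z\<close> is
  \<open>max z 0\<close>.
\<close>

definition T_plus ::
  "'j list \<Rightarrow> ('j \<Rightarrow> ('n::{finite,comm_ring_1}) qrep) \<Rightarrow> ('j \<Rightarrow> int) \<Rightarrow> 'n qrep" where
  "T_plus js T g = dsum_list (concat (map (\<lambda>j. replicate (nat (g j)) (T j)) js))"

definition T_minus ::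
  "'j list \<Rightarrow> ('j \<Rightarrow> ('n::{finite,comm_ring_1}) qrep) \<Rightarrow> ('j \<Rightarrow> int) \<Rightarrow> 'n qrep" where
  "T_minus js T g = dsum_list (concat (map (\<lambda>j. replicate (nat (- g j)) (T j)) js))"

text \<open>
  The dimension is upper semicontinuous in \<open>f\<close>, so its generic value is its minimum.  It depends
  only on the class of \<open>f\<close> in the stable category, so \<open>f\<close> may range over module homomorphisms.
\<close>

definition E_inv ::
  "nat \<Rightarrow> 'j list \<Rightarrow> ('j \<Rightarrow> ('n::{finite,comm_ring_1}) qrep) \<Rightarrow> ('j \<Rightarrow> int) \<Rightarrow> enat" where
  "E_inv k js T g =
     (INF f \<in> cm_hom (T_minus js T g) (T_plus js T g).
        let C = two_term (T_minus js T g) (T_plus js T g) f in hom_dim k C (shift C))"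

end

theory Submission
  imports Defs "Jordan_Normal_Form.Determinant"
begin

text \<open>
  Let \<open>M\<close> and \<open>N\<close> be the two terms of \<open>T\<^sub>f\<close>.  If \<open>Hom(T\<^sub>f, \<Sigma>T\<^sub>f) = 0\<close>, then the map
  \<open>(r, s) \<mapsto> rf - fs\<close> from \<open>End(N) \<oplus> End(M)\<close> to \<open>Hom(M, N)\<close>, all taken in the stable category, is
  surjective.  Between the summands that occur, stable morphism spaces are at most one-dimensional,
  and they are detected by the constant terms at vertex \<open>0\<close>; counting them shows that source and target
  both have dimension \<open>8t\<^sup>2\<close>.  But \<open>(1, 1)\<close> lies in the kernel.
\<close>

section \<open>Linear algebra\<close>

text \<open>Since \<open>card A = card B\<close>, the coefficients form a square matrix. Solving for
  the unit vectors gives a right inverse, which over a field is also a left inverse.\<close>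

lemma surjective_square_system_injective:
  fixes a :: "'b \<Rightarrow> 'a \<Rightarrow> 'f::field"
  assumes "finite A" "finite B" and card: "card A = card B"
    and surj: "\<And>h. \<exists>x. \<forall>b\<in>B. (\<Sum>j\<in>A. a b j * x j) = h b"
    and zero: "\<And>b. b \<in> B \<Longrightarrow> (\<Sum>j\<in>A. a b j * x j) = 0"
    and "j \<in> A"
  shows "x j = 0"
proof -
  define n where "n = card A"
  obtain p where p: "bij_betw p {0..<n} A"
    using ex_bij_betw_nat_finite[OF \<open>finite A\<close>] n_def by auto
  obtain q where q: "bij_betw q {0..<n} B"
    using ex_bij_betw_nat_finite[OF \<open>finite B\<close>] n_def card by auto
  have qB: "q i \<in> B" if "i < n" for i
    using q that by (auto simp: bij_betw_def)
  have q_inj: "q i = q k \<longleftrightarrow> i = k" if "i < n" "k < n" for i k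
    using q that by (auto simp: bij_betw_def inj_on_def)
  have reindex: "(\<Sum>j\<in>A. g j) = (\<Sum>i = 0..<n. g (p i))" for g :: "'a \<Rightarrow> 'f"
    using sum.reindex_bij_betw[OF p, of g] by simp
  obtain X where X: "\<And>k b. b \<in> B \<Longrightarrow> (\<Sum>j\<in>A. a b j * X k j) = (if b = q k then 1 else 0)"
    using surj[of "\<lambda>b. if b = q k then 1 else 0" for k] by metis
  define U where "U = mat n n (\<lambda>(i, j). a (q i) (p j))"
  define V where "V = mat n n (\<lambda>(j, k). X k (p j))"
  have UV: "U * V = 1\<^sub>m n"
  proof (rule eq_matI)
    fix i k assume "i < dim_row (1\<^sub>m n)" "k < dim_col (1\<^sub>m n)"
    then have "i < n" "k < n" by auto
    then have "(U * V) $$ (i, k) = (\<Sum>j = 0..<n. a (q i) (p j) * X k (p j))"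
      by (simp add: U_def V_def scalar_prod_def)
    also have "\<dots> = (\<Sum>j\<in>A. a (q i) j * X k j)"
      by (simp add: reindex)
    also have "\<dots> = 1\<^sub>m n $$ (i, k)"
      using X[OF qB[OF \<open>i < n\<close>], of k] \<open>i < n\<close> \<open>k < n\<close> by (simp add: q_inj)
    finally show "(U * V) $$ (i, k) = 1\<^sub>m n $$ (i, k)" .
  qed (auto simp: U_def V_def)
  have VU: "V * U = 1\<^sub>m n"
    by (rule mat_mult_left_right_inverse[OF _ _ UV]) (auto simp: U_def V_def)
  define y where "y = vec n (\<lambda>i. x (p i))"
  have "U *\<^sub>v y = 0\<^sub>v n"
  proof (rule eq_vecI)
    fix i assume "i < dim_vec (0\<^sub>v n)"
    then show "(U *\<^sub>v y) $ i = 0\<^sub>v n $ i"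
      using zero[OF qB, of i]
      by (simp add: U_def y_def scalar_prod_def reindex)
  qed (auto simp: U_def)
  then have "(V * U) *\<^sub>v y = 0\<^sub>v n"
    by (subst assoc_mult_mat_vec[of _ n n _ n]) (auto simp: U_def V_def y_def)
  then have "y = 0\<^sub>v n"
    by (simp add: VU y_def)
  moreover obtain i where "i < n" "j = p i"
    using p \<open>j \<in> A\<close> by (force simp: bij_betw_def)
  ultimately show ?thesis
    by (metis index_vec index_zero_vec(1) y_def)
qed

text \<open>\<open>PN\<close>, \<open>PM\<close> and \<open>W\<close> are the supports allowed for
  \<open>R\<close>, \<open>S\<close> and \<open>H\<close>. By \<open>card\<close>, the map (R, S)
  \<mapsto> RF - FS, read on \<open>W\<close>, goes between spaces of equal dimension; the pair of
  identity matrices is a nonzero element of its kernel, so it misses some \<open>H\<close>.\<close>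

lemma exists_not_commutator_combination:
  fixes F :: "nat \<Rightarrow> nat \<Rightarrow> 'f::field"
  assumes PN: "PN \<subseteq> {..<n} \<times> {..<n}" and PM: "PM \<subseteq> {..<m} \<times> {..<m}"
    and "finite W" and W: "W \<subseteq> {..<n} \<times> {..<m}"
    and diag: "\<And>i. i < n \<Longrightarrow> (i, i) \<in> PN" "\<And>i. i < m \<Longrightarrow> (i, i) \<in> PM"
    and "0 < n" and card: "card PN + card PM = card W"
  shows "\<exists>H. \<forall>R S. (\<forall>r k. (r, k) \<notin> PN \<longrightarrow> R r k = 0) \<longrightarrow> (\<forall>k c. (k, c) \<notin> PM \<longrightarrow> S k c = 0) \<longrightarrow>
           (\<exists>(r, c)\<in>W. H r c \<noteq> (\<Sum>k<n. R r k * F k c) - (\<Sum>k<m. F r k * S k c))"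
proof (rule ccontr)
  assume "\<not> ?thesis"
  then have solvable: "\<exists>R S. (\<forall>r k. (r, k) \<notin> PN \<longrightarrow> R r k = 0) \<and> (\<forall>k c. (k, c) \<notin> PM \<longrightarrow> S k c = 0) \<and>
      (\<forall>(r, c)\<in>W. H r c = (\<Sum>k<n. R r k * F k c) - (\<Sum>k<m. F r k * S k c))" for H
    by blast
  \<comment> \<open>The matrix of (R, S) \<mapsto> RF - FS: its columns are the unknown entries of
    \<open>R\<close> (\<open>Inl\<close>) and of \<open>S\<close> (\<open>Inr\<close>), its rows the
    positions in \<open>W\<close>.\<close>
  define a where "a = (\<lambda>(r, c) z. case z of
      Inl (r', k) \<Rightarrow> (if r' = r then F k c else 0)
    | Inr (k, c') \<Rightarrow> (if c' = c then - F r k else 0))"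
  have fin: "finite PN" "finite PM"
    using PN PM finite_subset by fastforce+
  have apply_a: "(\<Sum>j\<in>PN <+> PM. a (r, c) j * case_sum (\<lambda>(r, k). R r k) (\<lambda>(k, c). S k c) j) =
      (\<Sum>k<n. R r k * F k c) - (\<Sum>k<m. F r k * S k c)"
    if "(r, c) \<in> W" and R: "\<forall>r k. (r, k) \<notin> PN \<longrightarrow> R r k = 0"
      and S: "\<forall>k c. (k, c) \<notin> PM \<longrightarrow> S k c = 0" for r c R S
  proof -
    have rc: "r < n" "c < m" using W that by auto
    have "(\<Sum>(r', k)\<in>PN. (if r' = r then F k c else 0) * R r' k) =
        (\<Sum>(r', k)\<in>{..<n} \<times> {..<n}. (if r' = r then F k c else 0) * R r' k)"
      by (rule sum.mono_neutral_left) (use PN R in auto)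
    also have "\<dots> = (\<Sum>r'<n. \<Sum>k<n. (if r' = r then F k c else 0) * R r' k)"
      by (simp add: sum.cartesian_product)
    also have "\<dots> = (\<Sum>r'<n. if r' = r then \<Sum>k<n. F k c * R r k else 0)"
      by (rule sum.cong) auto
    also have "\<dots> = (\<Sum>k<n. R r k * F k c)"
      using rc by (simp add: mult.commute)
    finally have 1: "(\<Sum>(r', k)\<in>PN. (if r' = r then F k c else 0) * R r' k) =
        (\<Sum>k<n. R r k * F k c)" .
    have "(\<Sum>(k, c')\<in>PM. (if c' = c then - F r k else 0) * S k c') =
        (\<Sum>(k, c')\<in>{..<m} \<times> {..<m}. (if c' = c then - F r k else 0) * S k c')"
      by (rule sum.mono_neutral_left) (use PM S in auto)
    also have "\<dots> = (\<Sum>k<m. \<Sum>c'<m. (if c' = c then - F r k else 0) * S k c')"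
      by (simp add: sum.cartesian_product)
    also have "\<dots> = (\<Sum>k<m. \<Sum>c'<m. if c' = c then - F r k * S k c else 0)"
      by (intro sum.cong) auto
    also have "\<dots> = - (\<Sum>k<m. F r k * S k c)"
      using rc by (simp add: sum_negf)
    finally have 2: "(\<Sum>(k, c')\<in>PM. (if c' = c then - F r k else 0) * S k c') =
        - (\<Sum>k<m. F r k * S k c)" .
    show ?thesis
      using 1 2 by (simp add: sum.Plus fin a_def case_prod_unfold cong: if_cong)
  qed
  \<comment> \<open>\<open>?x\<close> encodes the pair of identity matrices; the membership tests
    supply the vanishing off \<open>PN\<close> and \<open>PM\<close> that \<open>apply_a\<close>
    asks for.\<close>
  let ?one = "\<lambda>i k::nat. if i = k then 1 else (0::'f)"
  let ?x = "case_sum (\<lambda>(r, k). if (r, k) \<in> PN then ?one r k else 0)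
                     (\<lambda>(k, c). if (k, c) \<in> PM then ?one k c else 0)"
  have "?x (Inl (0, 0)) = 0"
  proof (rule surjective_square_system_injective[where A = "PN <+> PM" and B = W and a = a and x = ?x])
    fix h :: "nat \<times> nat \<Rightarrow> 'f"
    obtain R S where RS: "\<forall>r k. (r, k) \<notin> PN \<longrightarrow> R r k = 0" "\<forall>k c. (k, c) \<notin> PM \<longrightarrow> S k c = 0"
      "\<forall>(r, c)\<in>W. h (r, c) = (\<Sum>k<n. R r k * F k c) - (\<Sum>k<m. F r k * S k c)"
      using solvable[of "curry h"] by (auto simp: curry_def)
    show "\<exists>x. \<forall>b\<in>W. (\<Sum>j\<in>PN <+> PM. a b j * x j) = h b"
      by (rule exI[of _ "case_sum (\<lambda>(r, k). R r k) (\<lambda>(k, c). S k c)"])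
        (use RS apply_a[OF _ RS(1,2)] in auto)
  next
    fix b assume b: "b \<in> W"
    obtain r c where rc: "b = (r, c)" by fastforce
    then have "r < n" "c < m" using W b by auto
    have "(\<Sum>j\<in>PN <+> PM. a (r, c) j * ?x j) =
        (\<Sum>k<n. (if (r, k) \<in> PN then ?one r k else 0) * F k c) -
        (\<Sum>k<m. F r k * (if (k, c) \<in> PM then ?one k c else 0))"
      by (rule apply_a) (use b rc in auto)
    also have "\<dots> = (\<Sum>k<n. if r = k then F k c else 0) - (\<Sum>k<m. if c = k then F r k else 0)"
      using diag \<open>r < n\<close> \<open>c < m\<close>
      by (intro arg_cong2[of _ _ _ _ "(-)"] sum.cong) auto
    also have "\<dots> = 0"
      using \<open>r < n\<close> \<open>c < m\<close> by simp
    finally show "(\<Sum>j\<in>PN <+> PM. a b j * ?x j) = 0" using rc by simp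
  qed (use fin card diag \<open>0 < n\<close> \<open>finite W\<close> in \<open>auto simp: card_Plus\<close>)
  then show False
    using diag(1)[OF \<open>0 < n\<close>] by simp
qed

text \<open>Turns a number of index pairs into a sum along the lists, which can be evaluated on
  lists built with \<open>replicate\<close>.\<close>

lemma card_index_pairs:
  "card {(r, c). r < length xs \<and> c < length ys \<and> P (ys ! c) (xs ! r)} =
    (\<Sum>x\<leftarrow>xs. length (filter (\<lambda>y. P y x) ys))"
proof -
  have "{(r, c). r < length xs \<and> c < length ys \<and> P (ys ! c) (xs ! r)} =
      (SIGMA r:{..<length xs}. {c. c < length ys \<and> P (ys ! c) (xs ! r)})"
    by auto
  then show ?thesis
    by (simp add: card_SigmaI length_filter_conv_card sum_list_sum_nth atLeast0LessThan)
qed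

section \<open>Sums of rank one modules\<close>

definition xarr :: "'n set \<Rightarrow> 'n \<Rightarrow> complex fps" where
  "xarr I i = (if i \<in> I then 1 else fps_X)"

definition yarr :: "'n set \<Rightarrow> 'n \<Rightarrow> complex fps" where
  "yarr I i = (if i \<in> I then fps_X else 1)"

lemma xarr_mult_yarr: "xarr I i * yarr I i = fps_X"
  by (simp add: xarr_def yarr_def)

text \<open>A closed form of \<open>dsum_list (map L Is)\<close>; the diagonal matrices allow
  morphisms to be treated entry by entry.\<close>

definition diag_rep :: "('n::{finite,comm_ring_1}) set list \<Rightarrow> 'n qrep" where
  "diag_rep Is = \<lparr>rk = (\<lambda>_. length Is),
     xm = (\<lambda>i. mat_diag (length Is) (\<lambda>r. xarr (Is ! r) i)),
     ym = (\<lambda>i. mat_diag (length Is) (\<lambda>r. yarr (Is ! r) i))\<rparr>"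

lemma rk_diag_rep [simp]: "rk (diag_rep Is) i = length Is"
  by (simp add: diag_rep_def)

lemma xm_diag_rep: "xm (diag_rep Is) i = mat_diag (length Is) (\<lambda>r. xarr (Is ! r) i)"
  by (simp add: diag_rep_def)

lemma ym_diag_rep: "ym (diag_rep Is) i = mat_diag (length Is) (\<lambda>r. yarr (Is ! r) i)"
  by (simp add: diag_rep_def)

lemma zero_rep_eq_diag_rep: "zero_rep = diag_rep []"
  by (auto simp: zero_rep_def diag_rep_def mat_diag_def intro!: eq_matI)

lemma dsum_L_diag_rep: "dsum (L I) (diag_rep Is) = diag_rep (I # Is)"
proof -
  have *: "four_block_mat (mat 1 1 (\<lambda>_. d 0)) (0\<^sub>m 1 n) (0\<^sub>m n 1) (mat_diag n (\<lambda>r. d (Suc r))) =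
      mat_diag (Suc n) d" for n and d :: "nat \<Rightarrow> complex fps"
    by (rule eq_matI) (auto simp: four_block_mat_def mat_diag_def Let_def nth_Cons')
  show ?thesis
    using *[of "\<lambda>r. xarr ((I # Is) ! r) i" "length Is" for i]
      *[of "\<lambda>r. yarr ((I # Is) ! r) i" "length Is" for i]
    by (simp add: dsum_def diag_rep_def L_def xarr_def yarr_def fun_eq_iff)
qed

lemma dsum_list_L: "dsum_list (map L Is) = diag_rep Is"
  by (induction Is) (simp_all add: dsum_list_def zero_rep_eq_diag_rep dsum_L_diag_rep)

lemma xpow_diag_rep:
  "xpow (diag_rep Is) m v = mat_diag (length Is) (\<lambda>r. \<Prod>j<m. xarr (Is ! r) (v + of_nat (Suc j)))"
  by (induction m) (simp_all add: xm_diag_rep mult.commute)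

lemma ypow_diag_rep:
  "ypow (diag_rep Is) m v = mat_diag (length Is) (\<lambda>r. \<Prod>j<m. yarr (Is ! r) (v - of_nat j))"
  by (induction m) (simp_all add: ym_diag_rep mult.commute)

lemma mat_diag_const: "mat_diag n (\<lambda>_. a) = a \<cdot>\<^sub>m 1\<^sub>m n" for a :: "complex fps"
  by (rule eq_matI) (auto simp: mat_diag_def)

lemma mat_diag_cong: "(\<And>r. r < n \<Longrightarrow> d r = e r) \<Longrightarrow> mat_diag n d = mat_diag n e"
  by (rule eq_matI) (auto simp: mat_diag_def)

text \<open>The relations xy = yx = t hold on each diagonal entry by \<open>xarr_mult_yarr\<close>;
  what remains is x^k = y^(n-k) on each summand.\<close>

lemma diag_rep_in_CM:
  fixes Is :: "('n::{finite,comm_ring_1}) set list"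
  assumes "\<And>I v. I \<in> set Is \<Longrightarrow>
    (\<Prod>j<k. xarr I (v + of_nat (Suc j))) = (\<Prod>j<CARD('n) - k. yarr I (v - of_nat j))"
  shows "diag_rep Is \<in> CM k"
  using assms
  by (auto simp: CM_def xpow_diag_rep ypow_diag_rep xm_diag_rep ym_diag_rep xarr_mult_yarr
      mult.commute[of "yarr _ _"] mat_diag_const simp del: of_nat_Suc intro!: mat_diag_cong)

definition rank_one_hom :: "('n::{finite,comm_ring_1}) set \<Rightarrow> 'n set \<Rightarrow> ('n \<Rightarrow> complex fps) \<Rightarrow> bool" where
  "rank_one_hom I J p \<longleftrightarrow> (\<forall>i. p i * xarr I i = xarr J i * p (i - 1))"

text \<open>Multiplying the relation for \<open>x\<close> by \<open>y\<close> on both sides gives that for \<open>y\<close>, up to the factor \<open>t\<close>.\<close>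
lemma rank_one_hom_yarr:
  assumes "rank_one_hom I J p"
  shows "p (i - 1) * yarr I i = yarr J i * p i"
proof -
  have "fps_X * (p (i - 1) * yarr I i) = (xarr J i * p (i - 1)) * yarr I i * yarr J i"
    by (simp add: xarr_mult_yarr[of J i, symmetric] mult_ac)
  also have "\<dots> = (p i * xarr I i) * yarr I i * yarr J i"
    using assms by (simp add: rank_one_hom_def)
  also have "\<dots> = fps_X * (yarr J i * p i)"
    by (simp add: xarr_mult_yarr[of I i, symmetric] mult_ac)
  finally show ?thesis by simp
qed

text \<open>Diagonal matrices scale rows and columns, so the commutation relations split into scalar
  relations, one per entry.\<close>

lemma cm_hom_diag_rep_iff:
  "f \<in> cm_hom (diag_rep Is) (diag_rep Js) \<longleftrightarrow>
    (\<forall>i. f i \<in> carrier_mat (length Js) (length Is)) \<and>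
    (\<forall>r < length Js. \<forall>c < length Is. rank_one_hom (Is ! c) (Js ! r) (\<lambda>i. f i $$ (r, c)))"
    (is "_ \<longleftrightarrow> ?carrier \<and> ?entries")
proof (cases ?carrier)
  case True
  then have "f i * xm (diag_rep Is) i = xm (diag_rep Js) i * f (i - 1) \<longleftrightarrow>
      (\<forall>r < length Js. \<forall>c < length Is.
        f i $$ (r, c) * xarr (Is ! c) i = xarr (Js ! r) i * f (i - 1) $$ (r, c))" for i
    unfolding xm_diag_rep
    by (subst mat_diag_mult_left[of _ _ "length Is"] mat_diag_mult_right[of _ "length Js"]; simp)+
      (auto simp: mat_eq_iff)
  moreover have "f (i - 1) * ym (diag_rep Is) i = ym (diag_rep Js) i * f i \<longleftrightarrow>
      (\<forall>r < length Js. \<forall>c < length Is.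
        f (i - 1) $$ (r, c) * yarr (Is ! c) i = yarr (Js ! r) i * f i $$ (r, c))" for i
    using True unfolding ym_diag_rep
    by (subst mat_diag_mult_left[of _ _ "length Is"] mat_diag_mult_right[of _ "length Js"]; simp)+
      (auto simp: mat_eq_iff)
  ultimately show ?thesis
    using True rank_one_hom_yarr[of _ _ "\<lambda>i. f i $$ (_, _)"]
    unfolding cm_hom_def by (auto simp: rank_one_hom_def)
qed (auto simp: cm_hom_def)

lemma mcomp_in_cm_hom:
  assumes f: "f \<in> cm_hom M N" and g: "g \<in> cm_hom N P"
    and M: "\<And>i. xm M i \<in> carrier_mat (rk M i) (rk M (i - 1))" "\<And>i. ym M i \<in> carrier_mat (rk M (i - 1)) (rk M i)"
    and N: "\<And>i. xm N i \<in> carrier_mat (rk N i) (rk N (i - 1))" "\<And>i. ym N i \<in> carrier_mat (rk N (i - 1)) (rk N i)"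
    and P: "\<And>i. xm P i \<in> carrier_mat (rk P i) (rk P (i - 1))" "\<And>i. ym P i \<in> carrier_mat (rk P (i - 1)) (rk P i)"
  shows "mcomp g f \<in> cm_hom M P"
proof -
  have fg: "\<And>i. f i \<in> carrier_mat (rk N i) (rk M i)" "\<And>i. g i \<in> carrier_mat (rk P i) (rk N i)"
    "\<And>i. f i * xm M i = xm N i * f (i - 1)" "\<And>i. f (i - 1) * ym M i = ym N i * f i"
    "\<And>i. g i * xm N i = xm P i * g (i - 1)" "\<And>i. g (i - 1) * ym N i = ym P i * g i"
    using f g by (auto simp: cm_hom_def)
  have "g i * f i * xm M i = xm P i * (g (i - 1) * f (i - 1))" for i
  proof -
    have "g i * f i * xm M i = g i * xm N i * f (i - 1)"
      by (simp add: assoc_mult_mat[OF fg(2,1) M(1)] assoc_mult_mat[OF fg(2) N(1) fg(1)] fg(3))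
    then show ?thesis
      by (simp add: assoc_mult_mat[OF P(1) fg(2) fg(1)] fg(5))
  qed
  moreover have "g (i - 1) * f (i - 1) * ym M i = ym P i * (g i * f i)" for i
  proof -
    have "g (i - 1) * f (i - 1) * ym M i = g (i - 1) * ym N i * f i"
      by (simp add: assoc_mult_mat[OF fg(2,1) M(2)] assoc_mult_mat[OF fg(2) N(2) fg(1)] fg(4))
    then show ?thesis
      by (simp add: assoc_mult_mat[OF P(2) fg(2) fg(1)] fg(6))
  qed
  ultimately show ?thesis
    using fg(1,2) by (auto simp: cm_hom_def mcomp_def intro!: mult_carrier_mat)
qed

section \<open>Morphisms at vertex 0\<close>

text \<open>The exponent of the power of t by which the path x_m ... x_1, starting at vertex 0, acts
  on \<open>L I\<close>.\<close>

primrec gaps :: "('n::comm_ring_1) set \<Rightarrow> nat \<Rightarrow> nat" where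
  "gaps I 0 = 0"
| "gaps I (Suc m) = gaps I m + of_bool (of_nat (Suc m) \<notin> I)"

text \<open>A morphism commutes with the path from vertex 0 to vertex \<open>m\<close>, which acts
  on both modules by powers of t.\<close>

lemma rank_one_hom_gaps:
  assumes "rank_one_hom I J p"
  shows "p (of_nat m) * fps_X ^ gaps I m = fps_X ^ gaps J m * p 0"
proof (induction m)
  case (Suc m)
  let ?i = "of_nat (Suc m)"
  have "p ?i * fps_X ^ gaps I (Suc m) = (p ?i * xarr I ?i) * fps_X ^ gaps I m"
    by (simp add: xarr_def)
  also have "p ?i * xarr I ?i = xarr J ?i * p (of_nat m)"
    using assms[unfolded rank_one_hom_def, rule_format, of ?i] by simp
  also have "\<dots> * fps_X ^ gaps I m = xarr J ?i * (p (of_nat m) * fps_X ^ gaps I m)"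
    by (simp only: mult.assoc)
  also have "\<dots> = fps_X ^ gaps J (Suc m) * p 0"
    unfolding Suc by (simp add: xarr_def)
  finally show ?case .
qed simp

text \<open>
  Comparing the sorted elements of \<open>I\<close> and \<open>J\<close> entry by entry, with \<open>9 = 0\<close> the largest element,
  this is the Gale order.  It characterizes when the generator of \<open>Hom(L\<^sub>I, L\<^sub>J)\<close> is a unit at vertex \<open>0\<close>.
\<close>
definition gale_le :: "9 set \<Rightarrow> 9 set \<Rightarrow> bool" where
  "gale_le I J \<longleftrightarrow> (\<forall>m<9. gaps I m \<le> gaps J m)"

lemma gale_le_refl [simp]: "gale_le I I"
  by (simp add: gale_le_def)

text \<open>At some \<open>m\<close> the exponent for \<open>I\<close> exceeds that for
  \<open>J\<close>; cancelling the smaller power of t shows that t divides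
  \<open>p 0\<close>.\<close>

lemma rank_one_hom_const_zero:
  assumes "rank_one_hom I J p" "\<not> gale_le I J"
  shows "fps_nth (p 0) 0 = 0"
proof -
  obtain m where m: "gaps J m < gaps I m"
    using assms(2) by (auto simp: gale_le_def not_le)
  then obtain d where d: "gaps I m = gaps J m + Suc d"
    using less_imp_Suc_add by (metis add_Suc_right)
  have "fps_X ^ gaps J m * p 0 = fps_X ^ gaps J m * (fps_X * (p (of_nat m) * fps_X ^ d))"
    using rank_one_hom_gaps[OF assms(1), of m] by (simp add: d power_add mult_ac)
  then have "p 0 = fps_X * (p (of_nat m) * fps_X ^ d)"
    by (simp only: mult_cancel_left) simp
  then show ?thesis by simp
qed

lemma UNIV_9: "(UNIV :: 9 set) = {0, 1, 2, 3, 4, 5, 6, 7, 8}"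
  by (rule card_subset_eq[symmetric]) simp_all

lemma ex_of_nat_9: "\<exists>m<9. i = (of_nat m :: 9)"
proof -
  have "\<forall>i\<in>UNIV. \<exists>m<9. i = (of_nat m :: 9)"
    unfolding UNIV_9 by (simp add: eval_nat_numeral Ex_less_Suc)
  then show ?thesis by simp
qed

text \<open>\<open>gaps\<close> is indexed by natural numbers; \<open>LEAST\<close> selects the
  representative in 0..8.\<close>

definition residue :: "9 \<Rightarrow> nat" where
  "residue i = (LEAST m. of_nat m = i)"

lemma residue_of_nat:
  assumes "m < 9"
  shows "residue (of_nat m) = m"
proof -
  have "\<forall>m<9. \<forall>y<m. (of_nat y :: 9) \<noteq> of_nat m"
    by (simp add: eval_nat_numeral All_less_Suc)
  then show ?thesis
    using assms unfolding residue_def by (intro Least_equality) (auto simp: not_less[symmetric])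
qed

text \<open>Once the value at vertex 0 is t^s, \<open>rank_one_hom_gaps\<close> forces the exponents
  at the other vertices. The truncated subtraction is exact under the assumption \<open>le\<close>
  of \<open>rank_one_hom_shift_hom\<close>.\<close>

definition shift_hom :: "nat \<Rightarrow> 9 set \<Rightarrow> 9 set \<Rightarrow> 9 \<Rightarrow> complex fps" where
  "shift_hom s I J i = fps_X ^ (s + gaps J (residue i) - gaps I (residue i))"

lemma shift_hom_0: "shift_hom s I J 0 = fps_X ^ s"
  using residue_of_nat[of 0] by (simp add: shift_hom_def)

lemma rank_one_hom_shift_hom:
  assumes le: "\<And>m. m < 9 \<Longrightarrow> gaps I m \<le> s + gaps J m" and eq: "gaps I 9 = gaps J 9"
  shows "rank_one_hom I J (shift_hom s I J)"
  unfolding rank_one_hom_def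
proof
  fix i :: 9
  obtain m where m: "m < 9" "i = of_nat m" using ex_of_nat_9 by blast
  have xarr: "xarr I' i = fps_X ^ of_bool (i \<notin> I')" for I'
    by (simp add: xarr_def)
  have "s + gaps J (residue i) - gaps I (residue i) + of_bool (i \<notin> I) =
      of_bool (i \<notin> J) + (s + gaps J (residue (i - 1)) - gaps I (residue (i - 1)))"
  proof (cases m)
    \<comment> \<open>The arrow from vertex 8 to vertex 9 = 0 closes the cycle; the exponents match
      there because \<open>I\<close> and \<open>J\<close> have equally many gaps
      (\<open>eq\<close>).\<close>
    case 0
    have nine: "of_nat (Suc 8) = (0::9)" by simp
    have "gaps I' (Suc 8) = gaps I' 8 + of_bool (0 \<notin> I')" for I' :: "9 set"
      by (simp only: gaps.simps nine)
    then have "gaps I 8 + of_bool (0 \<notin> I) = gaps J 8 + of_bool (0 \<notin> J)"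
      using eq by (simp del: gaps.simps)
    moreover have "i = 0" using m 0 by simp
    moreover have "i - 1 = of_nat 8" using \<open>i = 0\<close> by simp
    then have "residue (i - 1) = 8"
      by (simp only: residue_of_nat)
    moreover have "residue i = 0"
      using \<open>i = 0\<close> residue_of_nat[of 0] by simp
    ultimately show ?thesis
      using le[of 8] by simp
  next
    case (Suc l)
    then have "i - 1 = of_nat l" using m by simp
    then have "residue i = Suc l" "residue (i - 1) = l"
      using m Suc residue_of_nat[of l] residue_of_nat[of m] by simp_all
    moreover have "gaps I' (Suc l) = gaps I' l + of_bool (i \<notin> I')" for I'
      using m Suc by simp
    ultimately show ?thesis
      using le[of m] le[of l] m Suc by simp
  qed
  then show "shift_hom s I J i * xarr I i = xarr J i * shift_hom s I J (i - 1)"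
    unfolding shift_hom_def xarr power_add[symmetric] by simp
qed

section \<open>Constant terms of maps that factor through projectives\<close>

lemma CM_carrier:
  assumes "M \<in> CM k"
  shows "xm M i \<in> carrier_mat (rk M i) (rk M (i - 1))" "ym M i \<in> carrier_mat (rk M (i - 1)) (rk M i)"
  using assms by (auto simp: CM_def)

lemma diag_rep_carrier:
  "xm (diag_rep Is) i \<in> carrier_mat (rk (diag_rep Is) i) (rk (diag_rep Is) (i - 1))"
  "ym (diag_rep Is) i \<in> carrier_mat (rk (diag_rep Is) (i - 1)) (rk (diag_rep Is) i)"
  by (auto simp: xm_diag_rep ym_diag_rep)

text \<open>Only the surjection onto the summand \<open>J\<close> is lifted, so \<open>Ks\<close> need not consist of projectives.\<close>
lemma projective_factor_const_zero:
  assumes P: "cm_projective k P"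
    and u: "u \<in> cm_hom (diag_rep Is) P" and v: "v \<in> cm_hom P (diag_rep Js)"
    and r: "r < length Js" and c: "c < length Is"
    and CM: "diag_rep Ks \<in> CM k" "diag_rep [Js ! r] \<in> CM k"
    and p: "p \<in> cm_hom (diag_rep Ks) (diag_rep [Js ! r])"
    and surj: "cm_surj (diag_rep Ks) (diag_rep [Js ! r]) p"
    and vanish: "\<And>K. K \<in> set Ks \<Longrightarrow> \<not> gale_le (Is ! c) K \<or> \<not> gale_le K (Js ! r)"
  shows "fps_nth ((v 0 * u 0) $$ (r, c)) 0 = 0"
proof -
  have PCM: "P \<in> CM k" using P by (simp add: cm_projective_def)
  \<comment> \<open>The projection to the summand \<open>Js ! r\<close>. Lifting its composite with
    \<open>v\<close> along \<open>p\<close> reroutes the entry in question through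
    \<open>Ks\<close>.\<close>
  define e where "e = (\<lambda>_::9. mat 1 (length Js) (\<lambda>(_, j). if j = r then 1 else (0 :: complex fps)))"
  have e: "e \<in> cm_hom (diag_rep Js) (diag_rep [Js ! r])"
    using r by (auto simp: cm_hom_diag_rep_iff e_def rank_one_hom_def)
  have "mcomp e v \<in> cm_hom P (diag_rep [Js ! r])"
    by (rule mcomp_in_cm_hom[OF v e CM_carrier[OF PCM] diag_rep_carrier diag_rep_carrier])
  then obtain h where h: "h \<in> cm_hom P (diag_rep Ks)" "mcomp p h = mcomp e v"
    using P CM p surj unfolding cm_projective_def by blast
  have hu: "mcomp h u \<in> cm_hom (diag_rep Is) (diag_rep Ks)"
    by (rule mcomp_in_cm_hom[OF u h(1) diag_rep_carrier CM_carrier[OF PCM] diag_rep_carrier])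
  have dims: "u 0 \<in> carrier_mat (rk P 0) (length Is)" "v 0 \<in> carrier_mat (length Js) (rk P 0)"
    "h 0 \<in> carrier_mat (length Ks) (rk P 0)" "p 0 \<in> carrier_mat 1 (length Ks)"
    "e 0 \<in> carrier_mat 1 (length Js)"
    using u v h p e by (auto simp: cm_hom_def)
  have "p 0 * (h 0 * u 0) = e 0 * (v 0 * u 0)"
    using fun_cong[OF h(2), of 0]
    by (simp add: mcomp_def assoc_mult_mat[OF dims(4,3,1), symmetric]
        assoc_mult_mat[OF dims(5,2,1), symmetric])
  then have "(e 0 * (v 0 * u 0)) $$ (0, c) = (p 0 * (h 0 * u 0)) $$ (0, c)"
    by simp
  moreover have "(e 0 * (v 0 * u 0)) $$ (0, c) = (v 0 * u 0) $$ (r, c)"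
    using dims r c
    by (simp add: e_def scalar_prod_def if_distrib[of "\<lambda>x. x * _"] cong: if_cong)
  moreover have "(p 0 * (h 0 * u 0)) $$ (0, c) =
      (\<Sum>q<length Ks. p 0 $$ (0, q) * (h 0 * u 0) $$ (q, c))"
    using dims c by (simp add: scalar_prod_def atLeast0LessThan)
  \<comment> \<open>Each term is a composite through one \<open>L K\<close>, and one of its two
    factors has constant term 0 at vertex 0.\<close>
  moreover have "fps_nth (p 0 $$ (0, q) * (h 0 * u 0) $$ (q, c)) 0 = 0" if "q < length Ks" for q
  proof -
    have "rank_one_hom (Ks ! q) (Js ! r) (\<lambda>i. p i $$ (0, q))"
      using p that by (simp add: cm_hom_diag_rep_iff)
    moreover have "rank_one_hom (Is ! c) (Ks ! q) (\<lambda>i. (h i * u i) $$ (q, c))"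
      using hu that c by (simp add: cm_hom_diag_rep_iff mcomp_def)
    ultimately show ?thesis
      using vanish[of "Ks ! q"] that rank_one_hom_const_zero by fastforce
  qed
  ultimately show ?thesis
    by (simp add: fps_sum_nth del: fps_mult_nth_0)
qed

text \<open>The two maps to \<open>L J\<close> are 1 and t at vertex 0. By \<open>unit\<close>, one
  of them equals 1 at each vertex, so together they are onto.\<close>

lemma shift_hom_cover:
  fixes J K K' :: "9 set"
  assumes K: "\<forall>m<9. gaps K m \<le> gaps J m" "gaps K 9 = gaps J 9"
    and K': "\<forall>m<9. gaps K' m \<le> Suc (gaps J m)" "gaps K' 9 = gaps J 9"
    and unit: "\<forall>m<9. gaps K m = gaps J m \<or> gaps K' m = Suc (gaps J m)"
  shows "\<exists>p \<in> cm_hom (diag_rep [K, K']) (diag_rep [J]). cm_surj (diag_rep [K, K']) (diag_rep [J]) p"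
proof
  \<comment> \<open>\<open>q\<close> serves both as the position of the summand and as the exponent
    at vertex 0.\<close>
  define p where "p = (\<lambda>i. mat 1 2 (\<lambda>(_, q). shift_hom q ([K, K'] ! q) J i))"
  have "rank_one_hom K J (shift_hom 0 K J)" "rank_one_hom K' J (shift_hom 1 K' J)"
    using K K' by (auto intro!: rank_one_hom_shift_hom)
  then show "p \<in> cm_hom (diag_rep [K, K']) (diag_rep [J])"
    by (auto simp: cm_hom_diag_rep_iff p_def less_Suc_eq numeral_2_eq_2)
  show "cm_surj (diag_rep [K, K']) (diag_rep [J]) p"
    unfolding cm_surj_def
  proof (intro allI ballI)
    fix i :: 9 and w :: "complex fps vec" assume "w \<in> carrier_vec (rk (diag_rep [J]) i)"
    then have w: "w \<in> carrier_vec 1" by simp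
    obtain m where m: "m < 9" "i = of_nat m" using ex_of_nat_9 by blast
    then have "shift_hom 0 K J i = 1 \<or> shift_hom 1 K' J i = 1"
      using unit by (auto simp: shift_hom_def residue_of_nat)
    then obtain q where q: "q < 2" "shift_hom q ([K, K'] ! q) J i = 1"
      by (metis One_nat_def lessI nth_Cons_0 nth_Cons_Suc numeral_2_eq_2 zero_less_Suc)
    define v where "v = vec 2 (\<lambda>j. if j = q then w $ 0 else 0)"
    have "p i *\<^sub>v v = w"
      using w q by (intro eq_vecI)
        (auto simp: p_def v_def scalar_prod_def if_distrib[of "\<lambda>x. _ * x"] cong: if_cong)
    then show "\<exists>v\<in>carrier_vec (rk (diag_rep [K, K']) i). p i *\<^sub>v v = w"
      by (intro bexI[of _ v]) (auto simp: v_def)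
  qed
qed

text \<open>
  \<open>L\<^sub>J\<close> is a quotient of \<open>L\<^sub>1\<^sub>2\<^sub>3 \<oplus> L\<^sub>K\<close> for a cyclic interval \<open>K\<close>, but \<open>L\<^sub>I \<rightarrow> L\<^sub>1\<^sub>2\<^sub>3\<close> and
  \<open>L\<^sub>K \<rightarrow> L\<^sub>J\<close> vanish at vertex \<open>0\<close> modulo \<open>t\<close>.
\<close>
lemma projective_factor_const_zero_9:
  fixes Is Js :: "9 set list"
  assumes P: "cm_projective 3 P"
    and u: "u \<in> cm_hom (diag_rep Is) P" and v: "v \<in> cm_hom P (diag_rep Js)"
    and r: "r < length Js" and c: "c < length Is"
    and I: "Is ! c \<in> {{1,2,5}, {1,2,6}, {1,3,4}}"
    and J: "Js ! r \<in> {{1,2,8}, {1,5,6}, {1,6,7}}"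
  shows "fps_nth ((v 0 * u 0) $$ (r, c)) 0 = 0"
proof -
  \<comment> \<open>All sets whose modules occur in the covers, so that x^3 = y^6 is verified once
    for all of them.\<close>
  define S :: "9 set set" where
    "S = {{1,2,3}, {5,6,7}, {6,7,8}, {8,0,1}, {1,2,8}, {1,5,6}, {1,6,7}}"
  have "\<forall>I\<in>S. \<forall>v\<in>UNIV. (\<Prod>j<3. xarr I (v + of_nat (Suc j))) = (\<Prod>j<6. yarr I (v - of_nat j))"
    unfolding S_def UNIV_9 ball_simps by (simp add: eval_nat_numeral xarr_def yarr_def)
  then have CM: "diag_rep Ks \<in> CM 3" if "set Ks \<subseteq> S" for Ks
    using that by (intro diag_rep_in_CM) (simp_all add: subset_iff)
  \<comment> \<open>Cyclically, \<open>Js ! r\<close> consists of a run that begins with 1 and a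
    second run; \<open>K'\<close> is the interval of three elements that starts where the second run
    does.\<close>
  have "\<exists>K'\<in>{{5,6,7}, {6,7,8}, {8,0,1}}. \<not> gale_le K' (Js ! r) \<and>
      (\<exists>p \<in> cm_hom (diag_rep [{1,2,3}, K']) (diag_rep [Js ! r]).
        cm_surj (diag_rep [{1,2,3}, K']) (diag_rep [Js ! r]) p)"
    using J
  proof (elim insertE emptyE)
    assume "Js ! r = {1,2,8}"
    then show ?thesis
      using shift_hom_cover[of "{1,2,3}" "Js ! r" "{8,0,1}"]
      by (intro bexI[of _ "{8,0,1}"])
        (simp_all add: gale_le_def eval_nat_numeral All_less_Suc Ex_less_Suc)
  next
    assume "Js ! r = {1,5,6}"
    then show ?thesis
      using shift_hom_cover[of "{1,2,3}" "Js ! r" "{5,6,7}"]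
      by (intro bexI[of _ "{5,6,7}"])
        (simp_all add: gale_le_def eval_nat_numeral All_less_Suc Ex_less_Suc)
  next
    assume "Js ! r = {1,6,7}"
    then show ?thesis
      using shift_hom_cover[of "{1,2,3}" "Js ! r" "{6,7,8}"]
      by (intro bexI[of _ "{6,7,8}"])
        (simp_all add: gale_le_def eval_nat_numeral All_less_Suc Ex_less_Suc)
  qed
  then obtain K' p where K': "K' \<in> {{5,6,7}, {6,7,8}, {8,0,1}}" "\<not> gale_le K' (Js ! r)"
    and p: "p \<in> cm_hom (diag_rep [{1,2,3}, K']) (diag_rep [Js ! r])"
      "cm_surj (diag_rep [{1,2,3}, K']) (diag_rep [Js ! r]) p"
    by blast
  show ?thesis
  proof (rule projective_factor_const_zero[OF P u v r c _ _ p])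
    have "{1,2,3} \<in> S"
      by (simp only: S_def insert_iff simp_thms)
    moreover have "K' \<in> S"
      using K'(1) by (elim insertE emptyE) (simp_all only: S_def insert_iff simp_thms)
    moreover have "Js ! r \<in> S"
      using J by (elim insertE emptyE) (simp_all only: S_def insert_iff simp_thms)
    ultimately show "diag_rep [{1,2,3}, K'] \<in> CM 3" "diag_rep [Js ! r] \<in> CM 3"
      by (simp_all add: CM)
    have "\<not> gale_le (Is ! c) {1,2,3}"
      using I by (elim insertE emptyE) (simp_all add: gale_le_def eval_nat_numeral All_less_Suc)
    then show "\<not> gale_le (Is ! c) K \<or> \<not> gale_le K (Js ! r)" if "K \<in> set [{1,2,3}, K']" for K
      using that K'(2) by auto
  qed
qed

section \<open>Two-term complexes\<close>

lemma zero_mor_in_cm_hom: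
  assumes "\<And>i. xm M i \<in> carrier_mat (rk M i) (rk M (i - 1))" "\<And>i. ym M i \<in> carrier_mat (rk M (i - 1)) (rk M i)"
    and "\<And>i. xm N i \<in> carrier_mat (rk N i) (rk N (i - 1))" "\<And>i. ym N i \<in> carrier_mat (rk N (i - 1)) (rk N i)"
  shows "zero_mor M N \<in> cm_hom M N"
  by (simp add: cm_hom_def zero_mor_def left_mult_zero_mat[OF assms(1)] left_mult_zero_mat[OF assms(2)]
      right_mult_zero_mat[OF assms(3)] right_mult_zero_mat[OF assms(4)])

lemma cm_projective_zero_rep: "cm_projective k (zero_rep :: ('n::{finite,comm_ring_1}) qrep)"
  unfolding cm_projective_def
proof (intro conjI ballI impI)
  show Z: "(zero_rep :: 'n qrep) \<in> CM k"
    unfolding zero_rep_eq_diag_rep by (rule diag_rep_in_CM) simp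
  fix M N :: "'n qrep" and p g
  assume M: "M \<in> CM k" and p: "p \<in> cm_hom M N" and g: "g \<in> cm_hom zero_rep N"
  have "p i * 0\<^sub>m (rk M i) 0 = g i" for i
  proof -
    have "p i \<in> carrier_mat (rk N i) (rk M i)" "g i \<in> carrier_mat (rk N i) 0"
      using p g by (simp_all add: zero_rep_def cm_hom_def)
    then show ?thesis by (intro eq_matI) auto
  qed
  then have "mcomp p (zero_mor zero_rep M) = g"
    by (simp add: mcomp_def zero_mor_def zero_rep_def fun_eq_iff)
  then show "\<exists>h\<in>cm_hom zero_rep M. mcomp p h = g"
    using zero_mor_in_cm_hom[OF CM_carrier[OF Z] CM_carrier[OF M]] by blast
qed

text \<open>All matrices involved are empty, so the difference factors through the zero module,
  which is projective. This settles the chain map conditions of two-term complexes.\<close>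

lemma stable_eq_if_rk_0:
  fixes M N :: "('n::{finite,comm_ring_1}) qrep"
  assumes M: "M = diag_rep Is" and N: "N = diag_rep Js" and "Is = [] \<or> Js = []"
    and f: "\<And>i. f i \<in> carrier_mat (rk N i) (rk M i)" and g: "\<And>i. g i \<in> carrier_mat (rk N i) (rk M i)"
  shows "stable_eq k M N f g"
proof -
  let ?Z = "zero_rep :: 'n qrep"
  have Z: "?Z = diag_rep []" by (rule zero_rep_eq_diag_rep)
  have "zero_mor M ?Z \<in> cm_hom M ?Z" "zero_mor ?Z N \<in> cm_hom ?Z N"
    unfolding M N Z by (intro zero_mor_in_cm_hom diag_rep_carrier)+
  moreover have "mdiff f g i = mcomp (zero_mor ?Z N) (zero_mor M ?Z) i" for i
    using assms(3) f[of i] g[of i]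
    by (intro eq_matI) (auto simp: mdiff_def mcomp_def zero_mor_def M N Z)
  ultimately show ?thesis
    unfolding stable_eq_def using cm_projective_zero_rep by blast
qed

text \<open>
  A chain map \<open>T\<^sub>f \<rightarrow> \<Sigma>T\<^sub>f\<close> is an arbitrary morphism \<open>h\<close> between the two terms, and it is
  null-homotopic iff \<open>h = rf - fs\<close> in the stable category.
\<close>
lemma hom_basis_empty_imp:
  assumes basis: "hom_basis k C (shift C) {}"
    and C: "C = two_term (diag_rep Is) (diag_rep Js) f"
    and f: "f \<in> cm_hom (diag_rep Is) (diag_rep Js)"
    and h: "h \<in> cm_hom (diag_rep Is) (diag_rep Js)"
  obtains r s P u v where "r \<in> cm_hom (diag_rep Js) (diag_rep Js)" "s \<in> cm_hom (diag_rep Is) (diag_rep Is)"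
    "cm_projective k P" "u \<in> cm_hom (diag_rep Is) P" "v \<in> cm_hom P (diag_rep Js)"
    "\<And>i. h i - (- f i * s i + r i * f i) = v i * u i"
proof -
  \<comment> \<open>Writing the zero terms as \<open>diag_rep []\<close> lets all degrees be treated
    alike.\<close>
  define Ls where "Ls = (\<lambda>p::int. if p = -1 then Is else if p = 0 then Js else [])"
  have ob: "ob C p = diag_rep (Ls p)" "ob (shift C) p = diag_rep (Ls (p + 1))" for p
    by (auto simp: C two_term_def two_term_ob_def Ls_def shift_def zero_rep_eq_diag_rep)
  have fc: "f i \<in> carrier_mat (length Js) (length Is)" for i
    using f by (simp add: cm_hom_def)
  have df: "df C p i \<in> carrier_mat (length (Ls (p + 1))) (length (Ls p))" for p i
    using fc by (auto simp: C two_term_def two_term_ob_def Ls_def zero_mor_def zero_rep_eq_diag_rep)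
  have df_shift: "df (shift C) p i \<in> carrier_mat (length (Ls (p + 2))) (length (Ls (p + 1)))" for p i
    using df[of "p + 1" i] by (simp add: shift_def add.assoc)
  \<comment> \<open>Degree -1 is the only one where both the complex and its shift may be nonzero,
    so \<open>h\<close> sits there.\<close>
  define H where "H = (\<lambda>p. if p = -1 then h else zero_mor (ob C p) (ob (shift C) p))"
  have H: "H p \<in> cm_hom (ob C p) (ob (shift C) p)" for p
  proof (cases "p = -1")
    case True
    then show ?thesis using h by (simp add: H_def ob Ls_def)
  next
    case False
    then show ?thesis
      by (simp add: H_def ob del: rk_diag_rep) (intro zero_mor_in_cm_hom diag_rep_carrier)
  qed
  then have Hc: "H p i \<in> carrier_mat (length (Ls (p + 1))) (length (Ls p))" for p i
    by (auto simp: cm_hom_def ob)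
  have "stable_eq k (ob C p) (ob (shift C) (p + 1))
      (mcomp (df (shift C) p) (H p)) (mcomp (H (p + 1)) (df C p))" for p
  proof (rule stable_eq_if_rk_0[OF ob])
    \<comment> \<open>The composites go from degree \<open>p\<close> to degree \<open>p + 2\<close>
      of the complex, which occupies two adjacent degrees.\<close>
    show "Ls p = [] \<or> Ls (p + 1 + 1) = []" by (simp add: Ls_def)
    show "mcomp (df (shift C) p) (H p) i \<in> carrier_mat (rk (ob (shift C) (p + 1)) i) (rk (ob C p) i)" for i
      using mult_carrier_mat[OF df_shift[of p i] Hc[of p i]] by (simp add: mcomp_def ob add.assoc)
    show "mcomp (H (p + 1)) (df C p) i \<in> carrier_mat (rk (ob (shift C) (p + 1)) i) (rk (ob C p) i)" for i
      using mult_carrier_mat[OF Hc[of "p + 1" i] df[of p i]] by (simp add: mcomp_def ob add.assoc)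
  qed
  with H have "H \<in> chain_maps k C (shift C)"
    by (simp add: chain_maps_def)
  \<comment> \<open>The combination over the empty basis is zero, so \<open>H\<close> is
    null-homotopic.\<close>
  then obtain c where "homotopic k C (shift C) H (lin_comb C (shift C) c {})"
    using basis unfolding hom_basis_def by blast
  then obtain S where S: "\<And>p. S p \<in> cm_hom (ob C p) (ob (shift C) (p - 1))"
    "stable_eq k (ob C (-1)) (ob (shift C) (-1)) (mdiff (H (-1)) (lin_comb C (shift C) c {} (-1)))
       (madd (mcomp (df (shift C) (-1 - 1)) (S (-1))) (mcomp (S (-1 + 1)) (df C (-1))))"
    unfolding homotopic_def by blast
  have ob': "ob C (-1) = diag_rep Is" "ob (shift C) (-1) = diag_rep Js"
    by (simp_all add: ob Ls_def)
  obtain P u v where P: "cm_projective k P" "u \<in> cm_hom (diag_rep Is) P" "v \<in> cm_hom P (diag_rep Js)"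
    "mdiff (mdiff (H (-1)) (lin_comb C (shift C) c {} (-1)))
      (madd (mcomp (df (shift C) (-1 - 1)) (S (-1))) (mcomp (S (-1 + 1)) (df C (-1)))) = mcomp v u"
    using S(2) unfolding stable_eq_def ob' by blast
  have lin: "H (-1) i - lin_comb C (shift C) c {} (-1) i = h i" for i
  proof -
    have "h i \<in> carrier_mat (length Js) (length Is)"
      using h by (simp add: cm_hom_def)
    then show ?thesis
      by (intro eq_matI) (auto simp: H_def lin_comb_def ob Ls_def)
  qed
  \<comment> \<open>The minus sign comes from the differential of the shift. The homotopy has
    components \<open>S (-1)\<close> on the source of \<open>f\<close> and \<open>S 0\<close> on its
    target.\<close>
  have "h i - (- f i * S (-1) i + S 0 i * f i) = v i * u i" for i
    using fun_cong[OF P(4), of i] lin[of i]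
    by (simp add: mdiff_def madd_def mcomp_def C shift_def two_term_def)
  then show thesis
    using that[of "S 0" "S (-1)", OF _ _ P(1-3)] S(1)[of 0] S(1)[of "-1"]
    by (simp add: ob Ls_def)
qed

section \<open>Positivity from a dimension count\<close>

lemma INF_enat_eq_0:
  fixes F :: "'a \<Rightarrow> enat"
  assumes "(INF x\<in>A. F x) = 0"
  obtains x where "x \<in> A" "F x = 0"
proof -
  \<comment> \<open>The infimum of the empty set is \<infinity>; any other infimum in
    \<open>enat\<close> is attained.\<close>
  have "F ` A \<noteq> {}"
    using assms by (auto simp: top_enat_def)
  then have "Inf (F ` A) \<in> F ` A"
    by (metis Inf_enat_def LeastI_ex ex_in_conv)
  then show thesis using assms that by auto
qed

text \<open>\<open>card\<close> compares the numbers of entries that may have a nonzero constant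
  term at vertex 0. Taking these constant terms in h = rf - fs + vu, where vu contributes 0 at such
  entries, contradicts \<open>exists_not_commutator_combination\<close> for a suitable
  \<open>h\<close>.\<close>

lemma E_inv_pos:
  fixes Ms Ns :: "9 set list"
  assumes Ms: "T_minus Is L g = diag_rep Ms" "set Ms \<subseteq> {{1,2,5}, {1,2,6}, {1,3,4}}"
    and Ns: "T_plus Is L g = diag_rep Ns" "set Ns \<subseteq> {{1,2,8}, {1,5,6}, {1,6,7}}"
    and "Ns \<noteq> []"
    and card: "(\<Sum>J\<leftarrow>Ns. length (filter (\<lambda>K. gale_le K J) Ns)) +
        (\<Sum>J\<leftarrow>Ms. length (filter (\<lambda>K. gale_le K J) Ms)) =
        (\<Sum>J\<leftarrow>Ns. length (filter (\<lambda>K. gale_le K J) Ms))"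
  shows "E_inv 3 Is L g > 0"
proof (rule ccontr)
  assume "\<not> ?thesis"
  then have "E_inv 3 Is L g = 0" by simp
  then obtain f where f: "f \<in> cm_hom (diag_rep Ms) (diag_rep Ns)"
    and "hom_dim 3 (two_term (diag_rep Ms) (diag_rep Ns) f) (shift (two_term (diag_rep Ms) (diag_rep Ns) f)) = 0"
    unfolding E_inv_def Ms(1) Ns(1) Let_def by (rule INF_enat_eq_0)
  then obtain B where "hom_basis 3 (two_term (diag_rep Ms) (diag_rep Ns) f)
      (shift (two_term (diag_rep Ms) (diag_rep Ns) f)) B" "enat (card B) = 0"
    unfolding hom_dim_def mem_Collect_eq by (elim INF_enat_eq_0) simp
  \<comment> \<open>A basis is finite by definition, so cardinality 0 means that it is
    empty.\<close>
  then have basis: "hom_basis 3 (two_term (diag_rep Ms) (diag_rep Ns) f)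
      (shift (two_term (diag_rep Ms) (diag_rep Ns) f)) {}"
    by (auto simp: hom_basis_def zero_enat_def)
  let ?n = "length Ns" and ?m = "length Ms"
  define pairs :: "9 set list \<Rightarrow> 9 set list \<Rightarrow> (nat \<times> nat) set" where
    "pairs = (\<lambda>Js Is. {(r, c). r < length Js \<and> c < length Is \<and> gale_le (Is ! c) (Js ! r)})"
  define cst where "cst = (\<lambda>(g :: 9 mor) r c. fps_nth (g 0 $$ (r, c)) 0)"
  have "\<exists>H. \<forall>R S. (\<forall>r k. (r, k) \<notin> pairs Ns Ns \<longrightarrow> R r k = 0) \<longrightarrow> (\<forall>k c. (k, c) \<notin> pairs Ms Ms \<longrightarrow> S k c = 0) \<longrightarrow>
      (\<exists>(r, c)\<in>pairs Ns Ms. H r c \<noteq> (\<Sum>k<?n. R r k * cst f k c) - (\<Sum>k<?m. cst f r k * S k c))"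
  proof (rule exists_not_commutator_combination)
    have "pairs Ns Ms \<subseteq> {..<?n} \<times> {..<?m}" by (auto simp: pairs_def)
    then show "finite (pairs Ns Ms)" by (rule finite_subset) simp
    show "card (pairs Ns Ns) + card (pairs Ms Ms) = card (pairs Ns Ms)"
      using card unfolding pairs_def card_index_pairs .
  qed (use \<open>Ns \<noteq> []\<close> in \<open>auto simp: pairs_def\<close>)
  then obtain H where H: "\<And>R S. (\<forall>r k. (r, k) \<notin> pairs Ns Ns \<longrightarrow> R r k = 0) \<Longrightarrow>
      (\<forall>k c. (k, c) \<notin> pairs Ms Ms \<longrightarrow> S k c = 0) \<Longrightarrow>
      \<exists>(r, c)\<in>pairs Ns Ms. H r c \<noteq> (\<Sum>k<?n. R r k * cst f k c) - (\<Sum>k<?m. cst f r k * S k c)"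
    by blast
  \<comment> \<open>A morphism whose constant terms at vertex 0 are the prescribed
    \<open>H r c\<close> wherever the Gale order allows a unit.\<close>
  define h where "h = (\<lambda>i. mat ?n ?m (\<lambda>(r, c). if gale_le (Ms ! c) (Ns ! r)
      then fps_const (H r c) * shift_hom 0 (Ms ! c) (Ns ! r) i else 0))"
  \<comment> \<open>Nine indices minus three elements.\<close>
  have gaps6: "gaps I 9 = 6" if "I \<in> {{1,2,5}, {1,2,6}, {1,3,4}} \<union> {{1,2,8}, {1,5,6}, {1,6,7}}" for I :: "9 set"
    using that unfolding Un_iff
    by (elim disjE insertE emptyE) (simp_all add: eval_nat_numeral)
  have gaps9: "gaps (Ms ! c) 9 = gaps (Ns ! r) 9" if "r < ?n" "c < ?m" for r c
  proof -
    have "Ms ! c \<in> {{1,2,5}, {1,2,6}, {1,3,4}}" "Ns ! r \<in> {{1,2,8}, {1,5,6}, {1,6,7}}"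
      using subsetD[OF Ms(2) nth_mem] subsetD[OF Ns(2) nth_mem] that by blast+
    then show ?thesis
      using gaps6[OF UnI1] gaps6[OF UnI2] by presburger
  qed
  have "h \<in> cm_hom (diag_rep Ms) (diag_rep Ns)"
    unfolding cm_hom_diag_rep_iff
  proof (intro conjI allI impI)
    fix r c assume rc: "r < ?n" "c < ?m"
    have "rank_one_hom (Ms ! c) (Ns ! r) (shift_hom 0 (Ms ! c) (Ns ! r))"
      if "gale_le (Ms ! c) (Ns ! r)"
      using that gaps9[OF rc] by (intro rank_one_hom_shift_hom) (auto simp: gale_le_def)
    then show "rank_one_hom (Ms ! c) (Ns ! r) (\<lambda>i. h i $$ (r, c))"
      using rc by (auto simp: h_def rank_one_hom_def mult_ac)
  qed (simp add: h_def)
  then obtain R S P u v where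
    R: "R \<in> cm_hom (diag_rep Ns) (diag_rep Ns)" and S: "S \<in> cm_hom (diag_rep Ms) (diag_rep Ms)"
    and P: "cm_projective 3 P" and u: "u \<in> cm_hom (diag_rep Ms) P" and v: "v \<in> cm_hom P (diag_rep Ns)"
    and eq: "\<And>i. h i - (- f i * S i + R i * f i) = v i * u i"
    by (rule hom_basis_empty_imp[OF basis refl f]) blast
  have dims: "f 0 \<in> carrier_mat ?n ?m" "R 0 \<in> carrier_mat ?n ?n" "S 0 \<in> carrier_mat ?m ?m"
    "u 0 \<in> carrier_mat (rk P 0) ?m" "v 0 \<in> carrier_mat ?n (rk P 0)" "h 0 \<in> carrier_mat ?n ?m"
    using f R S u v by (auto simp: cm_hom_def h_def)
  \<comment> \<open>\<open>H\<close> speaks of functions on all pairs of natural numbers, so the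
    constant terms are extended by 0 beyond the matrix sizes.\<close>
  define R0 where "R0 = (\<lambda>r k. if r < ?n \<and> k < ?n then cst R r k else 0)"
  define S0 where "S0 = (\<lambda>k c. if k < ?m \<and> c < ?m then cst S k c else 0)"
  have "\<forall>r k. (r, k) \<notin> pairs Ns Ns \<longrightarrow> R0 r k = 0"
    using R unfolding cm_hom_diag_rep_iff R0_def cst_def pairs_def
    by (auto intro: rank_one_hom_const_zero[where p = "\<lambda>i. R i $$ (_, _)"])
  moreover have "\<forall>k c. (k, c) \<notin> pairs Ms Ms \<longrightarrow> S0 k c = 0"
    using S unfolding cm_hom_diag_rep_iff S0_def cst_def pairs_def
    by (auto intro: rank_one_hom_const_zero[where p = "\<lambda>i. S i $$ (_, _)"])
  ultimately obtain r c where rc: "(r, c) \<in> pairs Ns Ms"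
    and neq: "H r c \<noteq> (\<Sum>k<?n. R0 r k * cst f k c) - (\<Sum>k<?m. cst f r k * S0 k c)"
    using H by blast
  have "r < ?n" "c < ?m" and gale: "gale_le (Ms ! c) (Ns ! r)"
    using rc by (auto simp: pairs_def)
  have "fps_nth ((v 0 * u 0) $$ (r, c)) 0 = 0"
    by (rule projective_factor_const_zero_9[OF P u v \<open>r < ?n\<close> \<open>c < ?m\<close>
      subsetD[OF Ms(2) nth_mem[OF \<open>c < ?m\<close>]] subsetD[OF Ns(2) nth_mem[OF \<open>r < ?n\<close>]]])
  moreover have "(v 0 * u 0) $$ (r, c) = h 0 $$ (r, c) + (f 0 * S 0) $$ (r, c) - (R 0 * f 0) $$ (r, c)"
    using dims \<open>r < ?n\<close> \<open>c < ?m\<close> unfolding eq[symmetric]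
    by (simp add: uminus_mult_left_mat del: index_mult_mat) (simp add: algebra_simps)
  moreover have "fps_nth (h 0 $$ (r, c)) 0 = H r c"
    using \<open>r < ?n\<close> \<open>c < ?m\<close> gale by (simp add: h_def shift_hom_0)
  moreover have "fps_nth ((f 0 * S 0) $$ (r, c)) 0 = (\<Sum>k<?m. cst f r k * S0 k c)"
    using dims \<open>r < ?n\<close> \<open>c < ?m\<close>
    by (simp add: scalar_prod_def fps_sum_nth cst_def S0_def atLeast0LessThan)
  moreover have "fps_nth ((R 0 * f 0) $$ (r, c)) 0 = (\<Sum>k<?n. R0 r k * cst f k c)"
    using dims \<open>r < ?n\<close> \<open>c < ?m\<close>
    by (simp add: scalar_prod_def fps_sum_nth cst_def R0_def atLeast0LessThan)
  ultimately show False
    using neq by (simp add: algebra_simps)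
qed

section \<open>The Gale relations among the six summands\<close>

theorem proposition4p4:
  fixes Is :: "9 set list" and g :: "9 set \<Rightarrow> int" and t :: nat
  defines "Is \<equiv> [{1,2,4}, {1,2,5}, {1,2,6}, {1,2,7}, {1,2,8},
                 {1,3,4}, {1,4,5}, {1,5,6}, {1,6,7}, {1,7,8}]"
    and "g \<equiv> (\<lambda>I. if I \<in> {{1,3,4}, {1,2,5}, {1,2,6}} then -1
                   else if I \<in> {{1,5,6}, {1,6,7}, {1,2,8}} then 1
                   else 0)"
  assumes "t > 0"
  shows "E_inv 3 Is L (\<lambda>I. int t * g I) > 0"
proof -
  have g: "g {1,2,4} = 0" "g {1,2,5} = -1" "g {1,2,6} = -1" "g {1,2,7} = 0" "g {1,2,8} = 1"
    "g {1,3,4} = -1" "g {1,4,5} = 0" "g {1,5,6} = 1" "g {1,6,7} = 1" "g {1,7,8} = 0"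
    by (simp_all add: g_def set_eq_subset)
  define Ms :: "9 set list" where "Ms = replicate t {1,2,5} @ replicate t {1,2,6} @ replicate t {1,3,4}"
  define Ns :: "9 set list" where "Ns = replicate t {1,2,8} @ replicate t {1,5,6} @ replicate t {1,6,7}"
  show ?thesis
  proof (rule E_inv_pos)
    show "T_minus Is L (\<lambda>I. int t * g I) = diag_rep Ms"
      by (simp add: T_minus_def Is_def g Ms_def dsum_list_L[symmetric])
    show "T_plus Is L (\<lambda>I. int t * g I) = diag_rep Ns"
      by (simp add: T_plus_def Is_def g Ns_def dsum_list_L[symmetric])
    show "Ns \<noteq> []" using \<open>t > 0\<close> by (simp add: Ns_def)
    show "set Ms \<subseteq> {{1,2,5}, {1,2,6}, {1,3,4}}" "set Ns \<subseteq> {{1,2,8}, {1,5,6}, {1,6,7}}"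
      by (auto simp only: Ms_def Ns_def set_append set_replicate_conv_if split: if_splits)
    have "gale_le {1,2,5} {1,2,6}" "\<not> gale_le {1,2,6} {1,2,5}" "\<not> gale_le {1,2,5} {1,3,4}"
      "\<not> gale_le {1,2,6} {1,3,4}" "\<not> gale_le {1,3,4} {1,2,5}" "\<not> gale_le {1,3,4} {1,2,6}"
      "gale_le {1,5,6} {1,6,7}" "\<not> gale_le {1,6,7} {1,5,6}" "\<not> gale_le {1,2,8} {1,5,6}"
      "\<not> gale_le {1,2,8} {1,6,7}" "\<not> gale_le {1,5,6} {1,2,8}" "\<not> gale_le {1,6,7} {1,2,8}"
      "gale_le {1,2,5} {1,2,8}" "gale_le {1,2,5} {1,5,6}" "gale_le {1,2,5} {1,6,7}"
      "gale_le {1,2,6} {1,2,8}" "gale_le {1,2,6} {1,5,6}" "gale_le {1,2,6} {1,6,7}"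
      "\<not> gale_le {1,3,4} {1,2,8}" "gale_le {1,3,4} {1,5,6}" "gale_le {1,3,4} {1,6,7}"
      by (simp_all add: gale_le_def eval_nat_numeral All_less_Suc)
    \<comment> \<open>Each relation that holds contributes t^2. There are four within
      \<open>Ns\<close> (three reflexive ones and 156 \<le> 167), four within \<open>Ms\<close>
      (three reflexive ones and 125 \<le> 126), and eight from \<open>Ms\<close> to
      \<open>Ns\<close> (all but 134 \<le> 128).\<close>
    then show "(\<Sum>J\<leftarrow>Ns. length (filter (\<lambda>K. gale_le K J) Ns)) +
        (\<Sum>J\<leftarrow>Ms. length (filter (\<lambda>K. gale_le K J) Ms)) =
        (\<Sum>J\<leftarrow>Ns. length (filter (\<lambda>K. gale_le K J) Ms))"
      by (simp add: Ms_def Ns_def sum_list_replicate algebra_simps)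
  qed
qed

end
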